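(* Let $(X, d)$ be a metric space, let $T$ be a simplicial tree with metric $d_T$, and let $f : X \rightarrow T$ be a function. Suppose there exist positive integers $\ell, m, q \in \mathbb{Z}^+$ such that (a) each vertex in $T$ has valence at most $\ell$; (b) for all $x \in X$, $|B(x, m^2 + m)| \leq q$; and (c) for all $x, y \in X$, $\frac{1}{m} d(x, y) - m \leq d_T(f(x), f(y)) \leq m \cdot d(x, y) + m$. Then the abelian group $\mathbb{Z}[1/2]$ of dyadic rationals (under addition) is not isomorphic to a subgroup of $\mathfrak{B}\mathfrak{d}(X, d)$.
   Context: $\mathbb{Z}^+$ denotes the positive integers. For a set $X$, $\operatorname{Sym}(X)$ is the group of all bijections of $X$, acting on the right (the image of $x$ under $g$ is written $xg$). For a metric space $(X,d)$, $$\mathfrak{B}\mathfrak{d}(X, d) = \{g \in \operatorname{Sym}(X) \mid (\exists r_g \in \mathbb{Z}^+)(\forall x \in X)\ d(x, xg) \leq r_g\}$$ is the subgroup of $\operatorname{Sym}(X)$ of bounded displacement permutations. For $x \in X$ and $r$ a nonnegative real, $B(x, r) = \{y \in X \mid d(y, x) \leq r\}$ is the closed ball, and $|\cdot|$ denotes cardinality. A simplicial tree $T$ is regarded as the geometric realization of a graph-theoretic tree (connected, acyclic graph), including the points in the interiors of edges, with its path metric $d_T$ in which every edge has length $1$; $f$ may take any points of $T$ as values, not only vertices. The function $f$ is not assumed to be continuous or injective. *)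

theory Defs
  imports "HOL-Analysis.Abstract_Metric_Spaces" "HOL-Algebra.Bij"
begin

section \<open>Simplicial trees\<close>

text \<open>
  A tree has no loops or multiple edges, so a graph is given by a vertex set \<open>V\<close> (possibly
  infinite) and a set \<open>E\<close> of two-element subsets of \<open>V\<close>.
\<close>

definition graph_connected :: "'v set \<Rightarrow> 'v set set \<Rightarrow> bool" where
  "graph_connected V E \<longleftrightarrow> V \<noteq> {} \<and> (\<forall>u\<in>V. \<forall>v\<in>V. (u, v) \<in> {(a, b). {a, b} \<in> E}\<^sup>*)"

definition graph_cycle :: "'v set set \<Rightarrow> 'v list \<Rightarrow> bool" where
  "graph_cycle E vs \<longleftrightarrow> 3 \<le> length vs \<and> distinct vs \<and>
     successively (\<lambda>a b. {a, b} \<in> E) vs \<and> {last vs, hd vs} \<in> E"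

definition simplicial_tree :: "'v set \<Rightarrow> 'v set set \<Rightarrow> bool" where
  "simplicial_tree V E \<longleftrightarrow>
     (\<forall>e\<in>E. \<exists>u\<in>V. \<exists>v\<in>V. u \<noteq> v \<and> e = {u, v}) \<and>
     graph_connected V E \<and> (\<nexists>vs. graph_cycle E vs)"

text \<open>
  Points of the geometric realization are given by barycentric coordinates: the vertex \<open>u\<close> is the
  function that is 1 at \<open>u\<close> and 0 elsewhere, and the point at distance \<open>t\<close> from \<open>u\<close> on the
  edge \<open>{u, v}\<close> is the function with value \<open>1 - t\<close> at \<open>u\<close>, \<open>t\<close> at \<open>v\<close> and 0 elsewhere.
\<close>

definition supp :: "('v \<Rightarrow> real) \<Rightarrow> 'v set" where
  "supp p = {v. p v \<noteq> 0}"

definition realization :: "'v set \<Rightarrow> 'v set set \<Rightarrow> ('v \<Rightarrow> real) set" where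
  "realization V E = {p. (\<forall>v. 0 \<le> p v) \<and> ((\<exists>v\<in>V. supp p = {v}) \<or> supp p \<in> E) \<and>
     (\<Sum>v\<in>supp p. p v) = 1}"

text \<open>
  For points with parameters \<open>s\<close> and \<open>t\<close> on one closed edge of length 1, two barycentric
  coordinates differ, each by \<open>\<bar>s - t\<bar>\<close>; half of the sum is the distance along the edge.
\<close>

definition edge_dist :: "('v \<Rightarrow> real) \<Rightarrow> ('v \<Rightarrow> real) \<Rightarrow> real" where
  "edge_dist p q = (\<Sum>v\<in>supp p \<union> supp q. \<bar>p v - q v\<bar>) / 2"

text \<open>
  A piecewise linear path in the realization is given by its breakpoints, where consecutive
  breakpoints lie on a common closed edge. The path metric is the infimum of the lengths of
  piecewise linear paths between two points.
\<close>

definition pl_path :: "'v set \<Rightarrow> 'v set set \<Rightarrow> ('v \<Rightarrow> real) \<Rightarrow> ('v \<Rightarrow> real) \<Rightarrow> ('v \<Rightarrow> real) list \<Rightarrow> bool"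
  where
  "pl_path V E p q ps \<longleftrightarrow> ps \<noteq> [] \<and> hd ps = p \<and> last ps = q \<and> set ps \<subseteq> realization V E \<and>
     successively (\<lambda>x y. \<exists>e\<in>E. supp x \<subseteq> e \<and> supp y \<subseteq> e) ps"

definition pl_length :: "('v \<Rightarrow> real) list \<Rightarrow> real" where
  "pl_length ps = (\<Sum>i<length ps - 1. edge_dist (ps ! i) (ps ! Suc i))"

definition path_metric :: "'v set \<Rightarrow> 'v set set \<Rightarrow> ('v \<Rightarrow> real) \<Rightarrow> ('v \<Rightarrow> real) \<Rightarrow> real" where
  "path_metric V E p q = Inf {pl_length ps | ps. pl_path V E p q ps}"


section \<open>Bounded displacement permutations\<close>

text \<open>
  \<^const>\<open>BijGroup\<close> multiplies permutations as maps acting on the left. For the action on the right,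
  the product of \<open>g\<close> and \<open>h\<close> is \<open>g\<close> followed by \<open>h\<close>.
\<close>

definition Sym :: "'a set \<Rightarrow> ('a \<Rightarrow> 'a) monoid" where
  "Sym X = (BijGroup X)\<lparr>mult := \<lambda>g h. h \<otimes>\<^bsub>BijGroup X\<^esub> g\<rparr>"

definition bounded_displacement :: "'a set \<Rightarrow> ('a \<Rightarrow> 'a \<Rightarrow> real) \<Rightarrow> ('a \<Rightarrow> 'a) set" where
  "bounded_displacement X d =
     {g \<in> carrier (Sym X). \<exists>r::nat. 0 < r \<and> (\<forall>x\<in>X. d x (g x) \<le> real r)}"

definition Bd :: "'a set \<Rightarrow> ('a \<Rightarrow> 'a \<Rightarrow> real) \<Rightarrow> ('a \<Rightarrow> 'a) monoid" where
  "Bd X d = (Sym X)\<lparr>carrier := bounded_displacement X d\<rparr>"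

lemma carrier_Sym: "carrier (Sym X) = Bij X"
  by (simp add: Sym_def BijGroup_def)

lemma one_Sym: "\<one>\<^bsub>Sym X\<^esub> = (\<lambda>x\<in>X. x)"
  by (simp add: Sym_def BijGroup_def)

lemma mult_Sym: "g \<in> Bij X \<Longrightarrow> h \<in> Bij X \<Longrightarrow> g \<otimes>\<^bsub>Sym X\<^esub> h = (\<lambda>x\<in>X. h (g x))"
  by (simp add: Sym_def BijGroup_def compose_def)

lemma group_Sym: "group (Sym X)"
proof -
  interpret G: group "BijGroup X"
    by (rule group_BijGroup)
  show ?thesis
    unfolding Sym_def
    by (rule groupI) (auto simp: G.m_assoc intro: G.r_inv_ex)
qed

lemma subgroup_bounded_displacement:
  assumes "Metric_space X d"
  shows "subgroup (bounded_displacement X d) (Sym X)"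
proof -
  interpret Metric_space X d by fact
  interpret G: group "Sym X"
    by (rule group_Sym)
  have in_X: "g x \<in> X" if "g \<in> Bij X" "x \<in> X" for g x
    using that Bij_imp_funcset by blast
  show ?thesis
  proof (rule G.subgroupI)
    show "bounded_displacement X d \<subseteq> carrier (Sym X)"
      by (auto simp: bounded_displacement_def)
    have "\<one>\<^bsub>Sym X\<^esub> \<in> bounded_displacement X d"
      by (auto simp: bounded_displacement_def one_Sym carrier_Sym id_Bij intro!: exI[of _ 1])
    then show "bounded_displacement X d \<noteq> {}"
      by blast
  next
    fix g assume "g \<in> bounded_displacement X d"
    then obtain r :: nat where g: "g \<in> Bij X" and r: "0 < r" "\<And>x. x \<in> X \<Longrightarrow> d x (g x) \<le> r"
      by (auto simp: bounded_displacement_def carrier_Sym)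
    let ?h = "inv\<^bsub>Sym X\<^esub> g"
    have h: "?h \<in> Bij X"
      using g G.inv_closed[of g] by (simp add: carrier_Sym)
    have "?h \<otimes>\<^bsub>Sym X\<^esub> g = \<one>\<^bsub>Sym X\<^esub>"
      using g by (simp add: carrier_Sym G.l_inv)
    then have hg: "g (?h x) = x" if "x \<in> X" for x
      using that mult_Sym[OF h g] by (metis one_Sym restrict_apply')
    have "d x (?h x) \<le> r" if "x \<in> X" for x
      using r(2)[OF in_X[OF h that]] hg[OF that] by (simp add: commute)
    then show "?h \<in> bounded_displacement X d"
      using h r(1) by (auto simp: bounded_displacement_def carrier_Sym)
  next
    fix g h assume "g \<in> bounded_displacement X d" "h \<in> bounded_displacement X d"
    then obtain r s :: nat where g: "g \<in> Bij X" and h: "h \<in> Bij X" and "0 < r"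
      and r: "\<And>x. x \<in> X \<Longrightarrow> d x (g x) \<le> r" and s: "\<And>x. x \<in> X \<Longrightarrow> d x (h x) \<le> s"
      by (auto simp: bounded_displacement_def carrier_Sym)
    have "g \<otimes>\<^bsub>Sym X\<^esub> h \<in> carrier (Sym X)"
      using g h by (simp add: carrier_Sym[symmetric])
    moreover have "d x ((g \<otimes>\<^bsub>Sym X\<^esub> h) x) \<le> real (r + s)" if "x \<in> X" for x
      using triangle[of x "g x" "h (g x)"] r[OF that] s[OF in_X[OF g that]]
        in_X[OF g that] in_X[OF h in_X[OF g that]] that
      by (simp add: mult_Sym[OF g h])
    ultimately show "g \<otimes>\<^bsub>Sym X\<^esub> h \<in> bounded_displacement X d"
      using \<open>0 < r\<close> by (auto simp: bounded_displacement_def intro!: exI[of _ "r + s"])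
  qed
qed

lemma group_Bd: "Metric_space X d \<Longrightarrow> group (Bd X d)"
  unfolding Bd_def by (intro subgroup.subgroup_is_group subgroup_bounded_displacement group_Sym)


section \<open>The dyadic rationals\<close>

definition dyadic_group :: "rat monoid" where
  "dyadic_group =
     \<lparr>carrier = {of_int a / 2 ^ n | (a::int) (n::nat). True}, mult = (+), one = 0\<rparr>"

end

theory Submission
  imports Defs
begin

text \<open>
  The obstruction is that a bounded displacement permutation of \<open>X\<close> can be divided by \<open>2\<close> only
  finitely often, unless it has finite order. Two facts play against each other.

  A tree of bounded valence has very small cuts. Fix a root and, for a vertex \<open>v\<close>, let \<open>beyond v\<close>
  be the set of vertices that \<open>v\<close> separates from the root. The coarse inequalities for \<open>f\<close>
  give a map \<open>\<phi>\<close> from \<open>X\<close> to the vertices with fibres of at most \<open>q\<close> points that moves each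
  \<open>\<phi> x\<close> a bounded distance when \<open>x\<close> is moved to \<open>g x\<close>. A point that \<open>g\<close> carries across the
  cut given by \<open>v\<close> therefore lies over a ball around \<open>v\<close>, and the number of such points has a bound \<open>K\<close>
  that depends on \<open>g\<close> but not on \<open>v\<close> (\<open>few_crossings\<close>).

  Let now \<open>g = h\<^sup>N\<close> with \<open>N > K\<close>. Along an \<open>h\<close>-orbit, a window of \<open>N\<close> consecutive points on one
  side of a cut cannot be moved to a window on the other side: each of the \<open>N\<close> residue classes
  modulo \<open>N\<close> would have to cross, and each crossing is one by \<open>g\<close> (\<open>sweep\<close>). As \<open>h\<close> itself also
  crosses the cut at a bounded number of points, an orbit with many points on a side contains
  a window on that side. So for every cut all but boundedly many points of an \<open>h\<close>-orbit are on
  the same side (\<open>orbit_on_one_side\<close>).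

  A large set of vertices in a tree of bounded valence cannot have this property for all cuts:
  moving away from the root while almost all of the set stays ahead, one reaches a vertex at
  which it must branch into boundedly many small parts (\<open>one_sided_imp_small\<close>). Hence the orbits of
  \<open>h\<close> have bounded size, and \<open>h\<close> has finite order (\<open>deep_root_imp_finite_order\<close>).

  An embedding of the dyadic rationals sends \<open>1\<close> to such a \<open>g\<close> and \<open>1 / 2 ^ n\<close>, for \<open>n\<close> large, to
  such an \<open>h\<close>, but \<open>1 / 2 ^ n\<close> has infinite order.
\<close>

section \<open>Walks and cuts in a tree\<close>

definition adj :: "'v set set \<Rightarrow> ('v \<times> 'v) set" where
  "adj E = {(a, b). {a, b} \<in> E}"

lemma adj_sym: "(a, b) \<in> adj E \<longleftrightarrow> (b, a) \<in> adj E"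
  by (simp add: adj_def insert_commute)

lemma relpow_adj_sym: "(a, b) \<in> adj E ^^ n \<Longrightarrow> (b, a) \<in> adj E ^^ n"
proof (induction n arbitrary: b)
  case (Suc n)
  then obtain c where "(a, c) \<in> adj E ^^ n" "(c, b) \<in> adj E" by auto
  then show ?case using Suc.IH adj_sym[of c b] relpow_Suc_I2[of b c] by blast
qed auto

text \<open>
  A walk that returns to a vertex it has visited is cut back to the first visit.
\<close>

lemma rtrancl_imp_simple_path:
  assumes "(a, b) \<in> {(x, y). R x y}\<^sup>*"
  shows "\<exists>vs. vs \<noteq> [] \<and> distinct vs \<and> hd vs = a \<and> last vs = b \<and> successively R vs"
  using assms
proof (induction rule: rtrancl_induct)
  case base
  show ?case by (rule exI[of _ "[a]"]) simp
next
  case (step y z)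
  then obtain vs where vs: "vs \<noteq> []" "distinct vs" "hd vs = a" "last vs = y" "successively R vs"
    by blast
  show ?case
  proof (cases "z \<in> set vs")
    case True
    then obtain xs ys where "vs = xs @ z # ys" by (meson split_list)
    with vs show ?thesis
      by (intro exI[of _ "xs @ [z]"])
        (auto simp: successively_append_iff hd_append split: if_splits)
  next
    case False
    with vs step.hyps show ?thesis
      by (intro exI[of _ "vs @ [z]"]) (auto simp: successively_append_iff)
  qed
qed

text \<open>
  A simple path from \<open>a\<close> to \<open>b\<close> that does not use the edge between them closes up to a cycle
  with this edge. This is the only place where acyclicity enters.
\<close>

lemma edge_is_bridge:
  assumes tree: "simplicial_tree V E" and ab: "{a, b} \<in> E"
  shows "(a, b) \<notin> {(x, y). {x, y} \<in> E \<and> {x, y} \<noteq> {a, b}}\<^sup>*"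
proof
  assume "(a, b) \<in> {(x, y). {x, y} \<in> E \<and> {x, y} \<noteq> {a, b}}\<^sup>*"
  then obtain vs where vs: "vs \<noteq> []" "distinct vs" "hd vs = a" "last vs = b"
    "successively (\<lambda>x y. {x, y} \<in> E \<and> {x, y} \<noteq> {a, b}) vs"
    using rtrancl_imp_simple_path[of a b "\<lambda>x y. {x, y} \<in> E \<and> {x, y} \<noteq> {a, b}"] by blast
  have "a \<noteq> b"
    using tree ab unfolding simplicial_tree_def by (metis doubleton_eq_iff)
  have "3 \<le> length vs"
  proof (rule ccontr)
    assume "\<not> 3 \<le> length vs"
    then consider x where "vs = [x]" | x y where "vs = [x, y]"
      using vs(1) by (cases vs rule: remdups_adj.cases) (auto simp: not_le numeral_3_eq_3 less_Suc_eq)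
    then show False using vs \<open>a \<noteq> b\<close> by cases auto
  qed
  moreover have "successively (\<lambda>x y. {x, y} \<in> E) vs"
    using vs(5) by (rule successively_mono) simp
  moreover have "{last vs, hd vs} \<in> E"
    using vs(3,4) ab by (simp add: insert_commute)
  ultimately have "graph_cycle E vs"
    using vs(2) unfolding graph_cycle_def by blast
  then show False using tree unfolding simplicial_tree_def by blast
qed

text \<open>
  If removing \<open>v\<close> separates \<open>w\<close> from \<open>a\<close>, then every walk from \<open>a\<close> to \<open>w\<close> visits \<open>v\<close>, and its
  end piece is a walk from \<open>v\<close>.
\<close>

lemma rtrancl_passes:
  assumes "(a, w) \<in> {(x, y). R x y}\<^sup>*"
    and "(a, w) \<notin> {(x, y). R x y \<and> x \<noteq> v \<and> y \<noteq> v}\<^sup>*"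
  shows "(v, w) \<in> {(x, y). R x y}\<^sup>*"
  using assms
proof (induction rule: rtrancl_induct)
  case (step y w)
  let ?R = "{(x, y). R x y}" and ?Q = "{(x, y). R x y \<and> x \<noteq> v \<and> y \<noteq> v}"
  show ?case
  proof (cases "(a, y) \<in> ?Q\<^sup>*")
    case True
    with step.prems have "(y, w) \<notin> ?Q" by (meson rtrancl.rtrancl_into_rtrancl)
    then have "y = v \<or> w = v" using step.hyps by auto
    then show ?thesis using step.hyps(2) by auto
  next
    case False
    then show ?thesis using step.IH step.hyps(2) by (meson rtrancl.rtrancl_into_rtrancl)
  qed
qed simp

lemma rtrancl_last_exit:
  assumes "(v, w) \<in> {(x, y). R x y}\<^sup>*" and "w \<noteq> v"
  shows "\<exists>c. c \<noteq> v \<and> R v c \<and> (c, w) \<in> {(x, y). R x y \<and> x \<noteq> v \<and> y \<noteq> v}\<^sup>*"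
  using assms
proof (induction rule: rtrancl_induct)
  case (step y w)
  show ?case
  proof (cases "y = v")
    case True
    then show ?thesis using step.hyps step.prems by blast
  next
    case False
    then obtain c where "c \<noteq> v" "R v c" and c: "(c, y) \<in> {(x, y). R x y \<and> x \<noteq> v \<and> y \<noteq> v}\<^sup>*"
      using step.IH by blast
    moreover have "(y, w) \<in> {(x, y). R x y \<and> x \<noteq> v \<and> y \<noteq> v}"
      using step.hyps step.prems False by auto
    ultimately show ?thesis by (meson rtrancl.rtrancl_into_rtrancl)
  qed
qed simp

lemma rtrancl_sym_rel:
  assumes "(a, b) \<in> {(x, y). R x y}\<^sup>*" and "\<And>x y. R x y \<Longrightarrow> R y x"
  shows "(b, a) \<in> {(x, y). R x y}\<^sup>*"
  using assms(1)
proof (induction rule: rtrancl_induct)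
  case (step y z)
  then have "(z, y) \<in> {(x, y). R x y}" using assms(2) by simp
  then show ?case using step.IH by (rule converse_rtrancl_into_rtrancl)
qed simp

locale rooted_tree =
  fixes V :: "'v set" and E :: "'v set set" and z :: 'v
  assumes tree: "simplicial_tree V E" and z: "z \<in> V"
begin

text \<open>
  The vertices separated from the root \<open>z\<close> by \<open>v\<close>, with \<open>v\<close> itself; everything lies beyond the
  root. The cut is made at a vertex so that \<open>v\<close> is the only exit from \<open>beyond v\<close>.
\<close>

definition beyond :: "'v \<Rightarrow> 'v set" where
  "beyond v = {w \<in> V. v = z \<or> (z, w) \<notin> {(x, y). {x, y} \<in> E \<and> x \<noteq> v \<and> y \<noteq> v}\<^sup>*}"

lemma edge_in_V: "{a, b} \<in> E \<Longrightarrow> a \<in> V \<and> b \<in> V \<and> a \<noteq> b"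
  using tree unfolding simplicial_tree_def by (metis doubleton_eq_iff)

lemma connected: "a \<in> V \<Longrightarrow> b \<in> V \<Longrightarrow> (a, b) \<in> {(x, y). {x, y} \<in> E}\<^sup>*"
  using tree unfolding simplicial_tree_def graph_connected_def by blast

lemma connected_relpow: "a \<in> V \<Longrightarrow> b \<in> V \<Longrightarrow> \<exists>n. (a, b) \<in> adj E ^^ n"
  using connected rtrancl_imp_relpow unfolding adj_def by fast

lemma beyond_root: "beyond z = V"
  by (auto simp: beyond_def)

lemma root_beyond_iff: "z \<in> beyond v \<longleftrightarrow> v = z"
  using z by (auto simp: beyond_def)

lemma avoiding_neq:
  "(a, w) \<in> {(x, y). R x y \<and> x \<noteq> v \<and> y \<noteq> v}\<^sup>* \<Longrightarrow> a \<noteq> v \<Longrightarrow> w \<noteq> v"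
  by (erule rtranclE) auto

lemma self_beyond: "v \<in> V \<Longrightarrow> v \<in> beyond v"
  unfolding beyond_def using avoiding_neq[of z v _ v] by auto

lemma neighbour_beyond:
  assumes "w \<in> beyond v" "w \<noteq> v" "{w, w'} \<in> E"
  shows "w' \<in> beyond v"
proof (cases "v = z")
  case True
  then show ?thesis using edge_in_V[OF assms(3)] by (simp add: beyond_root)
next
  case False
  let ?Q = "{(x, y). {x, y} \<in> E \<and> x \<noteq> v \<and> y \<noteq> v}"
  have "(z, w') \<notin> ?Q\<^sup>*"
  proof
    assume *: "(z, w') \<in> ?Q\<^sup>*"
    then have "w' \<noteq> v" using False[symmetric] by (rule avoiding_neq)
    then have "(w', w) \<in> ?Q" using assms(2,3) by (simp add: insert_commute)
    with * have "(z, w) \<in> ?Q\<^sup>*" by (rule rtrancl_into_rtrancl)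
    then show False using assms(1) False by (simp add: beyond_def)
  qed
  then show ?thesis using edge_in_V[OF assms(3)] by (simp add: beyond_def)
qed

text \<open>
  Every vertex that has \<open>w\<close> beyond it lies on any fixed walk from the root to \<open>w\<close>.
\<close>

lemma finite_above:
  assumes "w \<in> V"
  shows "finite {v. w \<in> beyond v}"
  using connected[OF z assms]
proof (induction rule: rtrancl_induct)
  case base
  then show ?case by (simp add: root_beyond_iff)
next
  case (step y w)
  have "{w, y} \<in> E" using step.hyps(2) by (simp add: insert_commute)
  have "{v. w \<in> beyond v} \<subseteq> insert w {v. y \<in> beyond v}"
  proof
    fix v assume "v \<in> {v. w \<in> beyond v}"
    then show "v \<in> insert w {v. y \<in> beyond v}"
      using neighbour_beyond[of w v y] \<open>{w, y} \<in> E\<close> by (cases "v = w") simp_all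
  qed
  then show ?case by (rule finite_subset) (simp add: step.IH)
qed

text \<open>
  A walk out of \<open>beyond v\<close> has to pass through \<open>v\<close>, so that a point which crosses the cut in few
  steps is close to \<open>v\<close>.
\<close>

lemma leaving_beyond:
  assumes "(w, w') \<in> adj E ^^ n" "w \<in> beyond v" "w' \<notin> beyond v"
  shows "\<exists>k\<le>n. (w, v) \<in> adj E ^^ k"
  using assms
proof (induction n arbitrary: w)
  case (Suc n)
  show ?case
  proof (cases "w = v")
    case True
    then show ?thesis by (intro exI[of _ 0]) simp
  next
    case False
    obtain u where u: "(w, u) \<in> adj E" "(u, w') \<in> adj E ^^ n"
      using relpow_Suc_D2[OF Suc.prems(1)] by blast
    then have "u \<in> beyond v"
      using neighbour_beyond False Suc.prems(2) by (simp add: adj_def)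
    then obtain k where "k \<le> n" "(u, v) \<in> adj E ^^ k"
      using Suc.IH u Suc.prems(3) by blast
    then have "(w, v) \<in> adj E ^^ Suc k" by (intro relpow_Suc_I2[OF u(1)])
    moreover have "Suc k \<le> Suc n" using \<open>k \<le> n\<close> by simp
    ultimately show ?thesis by (intro exI conjI)
  qed
qed auto

text \<open>
  The set \<open>beyond v\<close> branches at \<open>v\<close> into sets of the same kind for neighbours of \<open>v\<close>. The
  neighbour \<open>c\<close> is the one through which a walk from \<open>v\<close> to \<open>w\<close> leaves \<open>v\<close> for the last time.
  If \<open>w\<close> were not beyond \<open>c\<close>, a walk from the root to \<open>w\<close> that avoids \<open>c\<close> would visit \<open>v\<close> and
  so join \<open>v\<close> to \<open>w\<close>, and then to \<open>c\<close>, without the edge between \<open>v\<close> and \<open>c\<close>.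
\<close>

lemma beyond_step:
  assumes w: "w \<in> beyond v" "w \<noteq> v" and v: "v \<in> V"
  shows "\<exists>c. {v, c} \<in> E \<and> w \<in> beyond c \<and> beyond c \<subset> beyond v"
proof -
  have wV: "w \<in> V" using w by (simp add: beyond_def)
  have off: "(z, u) \<notin> {(x, y). {x, y} \<in> E \<and> x \<noteq> v \<and> y \<noteq> v}\<^sup>*" if "u \<in> beyond v" "v \<noteq> z" for u
    using that by (simp add: beyond_def)
  obtain c where c: "c \<noteq> v" "{v, c} \<in> E"
    and cw: "(c, w) \<in> {(x, y). {x, y} \<in> E \<and> x \<noteq> v \<and> y \<noteq> v}\<^sup>*"
    using rtrancl_last_exit[OF connected[OF v wV] w(2)] by blast
  let ?Qv = "{(x, y). {x, y} \<in> E \<and> x \<noteq> v \<and> y \<noteq> v}"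
  let ?Qc = "{(x, y). {x, y} \<in> E \<and> x \<noteq> c \<and> y \<noteq> c}"
  let ?Qe = "{(x, y). {x, y} \<in> E \<and> {x, y} \<noteq> {v, c}}"
  have sub: "?Qv \<subseteq> ?Qe" "?Qc \<subseteq> ?Qe" by (auto simp: doubleton_eq_iff)
  have wc: "(w, c) \<in> ?Qv\<^sup>*"
    using cw by (rule rtrancl_sym_rel) (simp add: insert_commute)
  have cb: "c \<in> beyond v"
  proof (cases "v = z")
    case True
    then show ?thesis using edge_in_V[OF c(2)] by (simp add: beyond_root)
  next
    case False
    have "(z, c) \<notin> ?Qv\<^sup>*"
      using off[OF w(1) False] rtrancl_trans[OF _ cw] by blast
    then show ?thesis using edge_in_V[OF c(2)] by (simp add: beyond_def)
  qed
  have cz: "c \<noteq> z" using cb c(1) root_beyond_iff by metis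
  have wbc: "w \<in> beyond c"
  proof (rule ccontr)
    assume "w \<notin> beyond c"
    then have zw: "(z, w) \<in> ?Qc\<^sup>*" using wV by (simp add: beyond_def)
    have "(v, w) \<in> ?Qc\<^sup>*"
    proof (cases "v = z")
      case False
      have "(z, w) \<notin> {(x, y). ({x, y} \<in> E \<and> x \<noteq> c \<and> y \<noteq> c) \<and> x \<noteq> v \<and> y \<noteq> v}\<^sup>*"
        (is "_ \<notin> ?Q\<^sup>*")
      proof -
        have "?Q\<^sup>* \<subseteq> ?Qv\<^sup>*" by (rule rtrancl_mono) auto
        with off[OF w(1) False] show ?thesis by (rule contra_subsetD[rotated])
      qed
      then show ?thesis by (rule rtrancl_passes[OF zw])
    qed (use zw in simp)
    then have "(v, w) \<in> ?Qe\<^sup>*" by (rule subsetD[OF rtrancl_mono[OF sub(2)]])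
    also have "(w, c) \<in> ?Qe\<^sup>*" using wc by (rule subsetD[OF rtrancl_mono[OF sub(1)]])
    finally show False using edge_is_bridge[OF tree c(2)] by (rule notE[rotated])
  qed
  have below: "beyond c \<subseteq> beyond v"
  proof
    fix u assume u: "u \<in> beyond c"
    then have uV: "u \<in> V" and zu: "(z, u) \<notin> ?Qc\<^sup>*" using cz by (auto simp: beyond_def)
    show "u \<in> beyond v"
    proof (rule ccontr)
      assume "u \<notin> beyond v"
      then have vz: "v \<noteq> z" and zuv: "(z, u) \<in> ?Qv\<^sup>*" using uV by (auto simp: beyond_def)
      have "(z, u) \<notin> {(x, y). ({x, y} \<in> E \<and> x \<noteq> v \<and> y \<noteq> v) \<and> x \<noteq> c \<and> y \<noteq> c}\<^sup>*"
        (is "_ \<notin> ?Q\<^sup>*")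
      proof -
        have "?Q\<^sup>* \<subseteq> ?Qc\<^sup>*" by (rule rtrancl_mono) auto
        with zu show ?thesis by (rule contra_subsetD[rotated])
      qed
      from rtrancl_passes[OF zuv this] have "(c, u) \<in> ?Qv\<^sup>*" .
      then have "(u, c) \<in> ?Qv\<^sup>*"
        by (rule rtrancl_sym_rel) (simp add: insert_commute)
      with zuv have "(z, c) \<in> ?Qv\<^sup>*" by (rule rtrancl_trans)
      then show False using off[OF cb vz] by blast
    qed
  qed
  have "v \<notin> beyond c"
  proof
    assume vc: "v \<in> beyond c"
    show False
    proof (cases "v = z")
      case True
      then show False using vc c(1) root_beyond_iff by simp
    next
      case False
      (* the vertex u from which a walk from z first arrives at v is not beyond v *)
      obtain u where u: "{v, u} \<in> E" "(u, z) \<in> ?Qv\<^sup>*"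
        using rtrancl_last_exit[OF connected[OF v z] False[symmetric]] by blast
      have "(z, u) \<in> ?Qv\<^sup>*"
        using u(2) by (rule rtrancl_sym_rel) (simp add: insert_commute)
      then have "u \<notin> beyond v" using off[OF _ False] by blast
      then have "u \<notin> beyond c" using below by blast
      then show False using neighbour_beyond[OF vc c(1)[symmetric] u(1)] by contradiction
    qed
  qed
  then have "beyond c \<subset> beyond v" using self_beyond[OF v] below by (intro psubsetI) auto
  with c(2) wbc show ?thesis by (intro exI conjI)
qed

end

section \<open>Sweeping a window along an orbit\<close>

text \<open>
  When the window \<open>{t..<t + N}\<close> moves one step, the number of its elements satisfying \<open>P\<close> drops
  by at most one, and only if \<open>P\<close> holds at \<open>t\<close> and fails at \<open>t + N\<close>.
\<close>

lemma window_count: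
  fixes P :: "nat \<Rightarrow> bool"
  shows "card {i. i < N \<and> P i} \<le> card {i. k \<le> i \<and> i < k + N \<and> P i} + card {t. t < k \<and> P t \<and> \<not> P (t + N)}"
proof (induction k)
  case (Suc k)
  let ?F = "\<lambda>k. {i. k \<le> i \<and> i < k + N \<and> P i}" and ?D = "\<lambda>k. {t. t < k \<and> P t \<and> \<not> P (t + N)}"
  have fin: "finite (?F k)" "finite (?D k)" for k
    by (auto intro: finite_subset[of _ "{..<k + N}"])
  have "card (?F k) + card (?D k) \<le> card (?F (Suc k)) + card (?D (Suc k))"
  proof (cases "P k \<and> \<not> P (k + N)")
    case True
    then have "?D (Suc k) = insert k (?D k)" by (auto simp: less_Suc_eq)
    then have "card (?D (Suc k)) = Suc (card (?D k))" using fin by simp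
    moreover have "?F k \<subseteq> insert k (?F (Suc k))" by auto
    then have "card (?F k) \<le> card (insert k (?F (Suc k)))" using fin by (intro card_mono) auto
    then have "card (?F k) \<le> Suc (card (?F (Suc k)))" using fin
      by (simp add: card_insert_if split: if_splits)
    ultimately show ?thesis by simp
  next
    case False
    then have "?D (Suc k) = ?D k" by (auto simp: less_Suc_eq)
    moreover have "card (?F k) \<le> card (?F (Suc k))"
    proof (cases "P k \<and> N > 0")
      case True
      then have "?F (Suc k) = insert (k + N) (?F k - {k})" using False by (auto simp: less_Suc_eq)
      moreover have "k \<in> ?F k" using True by auto
      ultimately show ?thesis using fin
        by (metis (no_types, lifting) card_Suc_Diff1 card_insert_disjoint finite_Diff
            le_refl mem_Collect_eq DiffD1 less_irrefl)
    next
      case no: False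
      then have "?F k \<subseteq> ?F (Suc k)" by (auto simp: Suc_le_eq le_less)
      then show ?thesis using fin by (intro card_mono)
    qed
    ultimately show ?thesis by simp
  qed
  then show ?case using Suc.IH by linarith
qed simp

text \<open>
  Moving the window from \<open>a\<close> to \<open>(h ^^ k) a\<close> empties it of points of \<open>S\<close>, which takes at least
  \<open>N\<close> drops. Each drop is a point that \<open>h ^^ N\<close> takes out of \<open>S\<close>, and these points are distinct
  if \<open>k\<close> is minimal, also when the orbit is a cycle.
\<close>

lemma sweep:
  fixes h :: "'a \<Rightarrow> 'a"
  assumes h: "h \<in> X \<rightarrow> X" and a: "a \<in> X"
    and inS: "\<forall>j<N. (h ^^ j) a \<in> S"
    and out: "\<forall>j<N. (h ^^ (k + j)) a \<notin> S"
    and fin: "finite {x \<in> X. (x \<in> S) \<noteq> ((h ^^ N) x \<in> S)}"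
  shows "N \<le> card {x \<in> X. (x \<in> S) \<noteq> ((h ^^ N) x \<in> S)}"
  using out
proof (induction k rule: less_induct)
  case (less k)
  have X: "(h ^^ t) a \<in> X" for t
    by (induction t) (use a h in auto)
  show ?case
  proof (cases "inj_on (\<lambda>t. (h ^^ t) a) {..<k}")
    case True
    let ?P = "\<lambda>i. (h ^^ i) a \<in> S" and ?D = "{x \<in> X. (x \<in> S) \<noteq> ((h ^^ N) x \<in> S)}"
    have "{i. i < N \<and> ?P i} = {..<N}" using inS by auto
    moreover have "\<not> ?P i" if "k \<le> i" "i < k + N" for i
      using less.prems[rule_format, of "i - k"] that by simp
    then have "{i. k \<le> i \<and> i < k + N \<and> ?P i} = {}" by blast
    ultimately have "N \<le> card {t. t < k \<and> ?P t \<and> \<not> ?P (t + N)}"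
      using window_count[of N ?P k] by (simp only: card.empty card_lessThan add_0)
    also have "\<dots> = card ((\<lambda>t. (h ^^ t) a) ` {t. t < k \<and> ?P t \<and> \<not> ?P (t + N)})"
      by (rule card_image[symmetric]) (rule inj_on_subset[OF True], auto)
    also have "\<dots> \<le> card ?D"
    proof (rule card_mono[OF fin], rule image_subsetI)
      fix t assume "t \<in> {t. t < k \<and> ?P t \<and> \<not> ?P (t + N)}"
      then have t: "?P t" "\<not> ?P (t + N)" by auto
      then have "(h ^^ N) ((h ^^ t) a) \<notin> S" by (simp add: funpow_add add.commute[of t])
      with t X show "(h ^^ t) a \<in> ?D" by simp
    qed
    finally show ?thesis .
  next
    case False
    (* a repeated point gives a shortcut: the same window is reached after fewer steps *)
    then obtain s t where st: "s < t" "t < k" "(h ^^ s) a = (h ^^ t) a"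
      unfolding inj_on_def by (metis lessThan_iff linorder_neqE_nat)
    have "(h ^^ (k - (t - s) + j)) a = (h ^^ (k + j)) a" for j
    proof -
      have "(h ^^ (k - t + j + s)) a = (h ^^ (k - t + j + t)) a"
        using st(3) by (simp add: funpow_add)
      moreover have "k - t + j + s = k - (t - s) + j" "k - t + j + t = k + j" using st by auto
      ultimately show ?thesis by metis
    qed
    then show ?thesis using less.IH[of "k - (t - s)"] st less.prems by simp
  qed
qed

lemma funpow_in: "h \<in> X \<rightarrow> X \<Longrightarrow> x \<in> X \<Longrightarrow> (h ^^ k) x \<in> X"
  by (induction k) auto

lemma inj_on_funpow_on:
  assumes "h \<in> X \<rightarrow> X" "inj_on h X"
  shows "inj_on (h ^^ k) X"
proof (induction k)
  case (Suc k)
  show ?case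
  proof (rule inj_onI)
    fix x y assume "x \<in> X" "y \<in> X" "(h ^^ Suc k) x = (h ^^ Suc k) y"
    then show "x = y"
      using Suc funpow_in[OF assms(1)] assms(2) by (auto simp: inj_on_def)
  qed
qed simp

text \<open>
  A point of \<open>S\<close> that leaves \<open>S\<close> in less than \<open>N\<close> steps is determined by the number of steps and
  by the point at which \<open>h\<close> exits.
\<close>

lemma few_short_runs:
  assumes h: "h \<in> X \<rightarrow> X" "inj_on h X"
    and fin: "finite {x \<in> X. (x \<in> S) \<noteq> (h x \<in> S)}"
    and C: "card {x \<in> X. (x \<in> S) \<noteq> (h x \<in> S)} \<le> C"
  shows "finite {x \<in> X. x \<in> S \<and> \<not> (\<forall>j<N. (h ^^ j) x \<in> S)}"
    and "card {x \<in> X. x \<in> S \<and> \<not> (\<forall>j<N. (h ^^ j) x \<in> S)} \<le> N * C"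
proof -
  let ?D = "{x \<in> X. (x \<in> S) \<noteq> (h x \<in> S)}"
  let ?U = "\<lambda>j. {x \<in> X. (h ^^ j) x \<in> ?D}"
  have inj: "inj_on (h ^^ j) (?U j)" for j
    using inj_on_funpow_on[OF h] by (rule inj_on_subset) auto
  have im: "(h ^^ j) ` ?U j \<subseteq> ?D" for j by auto
  have U: "finite (?U j)" "card (?U j) \<le> C" for j
    using inj_on_finite[OF inj im fin] card_inj_on_le[OF inj im fin] C by (auto intro: order_trans)
  have sub: "{x \<in> X. x \<in> S \<and> \<not> (\<forall>j<N. (h ^^ j) x \<in> S)} \<subseteq> (\<Union>j<N. ?U j)"
  proof
    fix x assume "x \<in> {x \<in> X. x \<in> S \<and> \<not> (\<forall>j<N. (h ^^ j) x \<in> S)}"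
    then obtain j where x: "x \<in> X" "x \<in> S" "j < N" "(h ^^ j) x \<notin> S" by blast
    define i where "i = (LEAST i. (h ^^ i) x \<notin> S)"
    have i: "(h ^^ i) x \<notin> S" "i \<le> j"
      unfolding i_def using x LeastI[of "\<lambda>i. (h ^^ i) x \<notin> S"] Least_le[of "\<lambda>i. (h ^^ i) x \<notin> S"] by blast+
    then obtain i' where i': "i = Suc i'" using x by (cases i) auto
    then have "(h ^^ i') x \<in> S" using not_less_Least[of i' "\<lambda>i. (h ^^ i) x \<notin> S"] i_def by auto
    then have "x \<in> ?U i'" "i' < N" using i i' x funpow_in[OF h(1) x(1), of i'] by auto
    then show "x \<in> (\<Union>j<N. ?U j)" by blast
  qed
  show "finite {x \<in> X. x \<in> S \<and> \<not> (\<forall>j<N. (h ^^ j) x \<in> S)}"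
    using sub by (rule finite_subset) (use U in blast)
  have "card {x \<in> X. x \<in> S \<and> \<not> (\<forall>j<N. (h ^^ j) x \<in> S)} \<le> card (\<Union>j<N. ?U j)"
    using sub U by (intro card_mono) auto
  also have "\<dots> \<le> (\<Sum>j<N. card (?U j))" by (rule card_UN_le) simp
  also have "\<dots> \<le> (\<Sum>j<N. C)" using U by (intro sum_mono) auto
  finally show "card {x \<in> X. x \<in> S \<and> \<not> (\<forall>j<N. (h ^^ j) x \<in> S)} \<le> N * C" by simp
qed

text \<open>
  An orbit with more than \<open>N * C\<close> points on both sides contains a full window on either side. One
  of them comes first on the forward orbit, and sweeping from it to the other contradicts
  the bound on the crossings of \<open>h ^^ N\<close>. Forward orbits suffice because the hypotheses and the
  conclusion are symmetric under \<open>S \<mapsto> - S\<close>.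
\<close>

lemma orbit_on_one_side:
  assumes h: "h \<in> X \<rightarrow> X" "inj_on h X" and x0: "x0 \<in> X"
    and fin: "finite {x \<in> X. (x \<in> S) \<noteq> (h x \<in> S)}"
    and C: "card {x \<in> X. (x \<in> S) \<noteq> (h x \<in> S)} \<le> C"
    and finN: "finite {x \<in> X. (x \<in> S) \<noteq> ((h ^^ N) x \<in> S)}"
    and N: "card {x \<in> X. (x \<in> S) \<noteq> ((h ^^ N) x \<in> S)} < N"
  defines "Y \<equiv> range (\<lambda>k. (h ^^ k) x0)"
  shows "finite (Y \<inter> S) \<and> card (Y \<inter> S) \<le> N * C \<or> finite (Y - S) \<and> card (Y - S) \<le> N * C"
proof (rule ccontr)
  assume neg: "\<not> ?thesis"
  have YX: "Y \<subseteq> X" unfolding Y_def using funpow_in[OF h(1) x0] by auto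
  have ex: "\<exists>s. \<forall>j<N. (h ^^ (s + j)) x0 \<in> A"
    if A: "\<not> (finite (Y \<inter> A) \<and> card (Y \<inter> A) \<le> N * C)"
      and eq: "{x \<in> X. (x \<in> A) \<noteq> (h x \<in> A)} = {x \<in> X. (x \<in> S) \<noteq> (h x \<in> S)}" for A
  proof -
    note short = few_short_runs[OF h, of A C N, unfolded eq, OF fin C]
    have "\<not> Y \<inter> A \<subseteq> {x \<in> X. x \<in> A \<and> \<not> (\<forall>j<N. (h ^^ j) x \<in> A)}"
      using A short card_mono finite_subset order_trans by meson
    then obtain x where "x \<in> Y" "\<forall>j<N. (h ^^ j) x \<in> A" using YX by blast
    then obtain s where "\<forall>j<N. (h ^^ j) ((h ^^ s) x0) \<in> A" unfolding Y_def by blast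
    then show ?thesis by (intro exI[of _ s]) (simp add: funpow_add add.commute[of s])
  qed
  have "Y - S = Y \<inter> - S" by blast
  then obtain s t where s: "\<forall>j<N. (h ^^ (s + j)) x0 \<in> S" and t: "\<forall>j<N. (h ^^ (t + j)) x0 \<in> - S"
    using ex[of S] ex[of "- S"] neg by auto
  have run: "N \<le> card {x \<in> X. (x \<in> A) \<noteq> ((h ^^ N) x \<in> A)}"
    if "s \<le> t" "\<forall>j<N. (h ^^ (s + j)) x0 \<in> A" "\<forall>j<N. (h ^^ (t + j)) x0 \<notin> A"
      "finite {x \<in> X. (x \<in> A) \<noteq> ((h ^^ N) x \<in> A)}" for s t A
  proof (rule sweep[OF h(1) funpow_in[OF h(1) x0, of s], where k = "t - s"])
    show "\<forall>j<N. (h ^^ j) ((h ^^ s) x0) \<in> A"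
      using that(2) by (simp add: funpow_add add.commute[of s])
    show "\<forall>j<N. (h ^^ (t - s + j)) ((h ^^ s) x0) \<notin> A"
    proof (intro allI impI)
      fix j assume "j < N"
      have "(h ^^ (t - s + j)) ((h ^^ s) x0) = (h ^^ (t - s + j + s)) x0"
        by (simp only: funpow_add o_apply)
      also have "t - s + j + s = t + j" using that(1) by simp
      finally show "(h ^^ (t - s + j)) ((h ^^ s) x0) \<notin> A" using that(3) \<open>j < N\<close> by simp
    qed
  qed (use that in simp)
  have eq: "{x \<in> X. (x \<in> - S) \<noteq> ((h ^^ N) x \<in> - S)} = {x \<in> X. (x \<in> S) \<noteq> ((h ^^ N) x \<in> S)}"
    by auto
  show False
  proof (cases "s \<le> t")
    case True
    then show False using run[OF True s] t finN N by simp
  next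
    case False
    then show False using run[of t s "- S"] s t finN N eq by simp
  qed
qed

section \<open>Trees of bounded valence\<close>

lemma card_neighbours:
  assumes "finite {e \<in> E. v \<in> e}" "card {e \<in> E. v \<in> e} \<le> l"
  shows "finite {w. {w, v} \<in> E}" "card {w. {w, v} \<in> E} \<le> l"
proof -
  have inj: "inj_on (\<lambda>w. {w, v}) {w. {w, v} \<in> E}"
    by (auto simp: inj_on_def doubleton_eq_iff)
  have im: "(\<lambda>w. {w, v}) ` {w. {w, v} \<in> E} \<subseteq> {e \<in> E. v \<in> e}" by auto
  show "finite {w. {w, v} \<in> E}" using inj_on_finite[OF inj im assms(1)] .
  show "card {w. {w, v} \<in> E} \<le> l" using card_inj_on_le[OF inj im assms(1)] assms(2) by linarith
qed

locale bounded_valence_tree = rooted_tree V E z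
  for V :: "'v set" and E :: "'v set set" and z :: 'v +
  fixes l :: nat
  assumes valence: "\<And>v. v \<in> V \<Longrightarrow> finite {e \<in> E. v \<in> e}" "\<And>v. v \<in> V \<Longrightarrow> card {e \<in> E. v \<in> e} \<le> l"
begin

lemma card_ball:
  assumes v: "v \<in> V"
  shows "finite {w. \<exists>k\<le>n. (w, v) \<in> adj E ^^ k} \<and> card {w. \<exists>k\<le>n. (w, v) \<in> adj E ^^ k} \<le> (l + 1) ^ n"
proof (induction n)
  case (Suc n)
  define B where "B n = {w. \<exists>k\<le>n. (w, v) \<in> adj E ^^ k}" for n
  have IH: "finite (B n)" "card (B n) \<le> (l + 1) ^ n" using Suc.IH by (auto simp: B_def)
  have BV: "u \<in> V" if uv: "(u, v) \<in> adj E ^^ k" for u k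
  proof (cases k)
    case (Suc j)
    then obtain y where "(u, y) \<in> adj E" using uv relpow_Suc_D2[of u v j "adj E"] by blast
    then show ?thesis using edge_in_V by (simp add: adj_def)
  qed (use uv v in simp)
  have B: "u \<in> V" if "u \<in> B n" for u using that BV by (auto simp: B_def)
  have sub: "B (Suc n) \<subseteq> B n \<union> (\<Union>u\<in>B n. {w. {w, u} \<in> E})"
  proof
    fix w assume "w \<in> B (Suc n)"
    then obtain k where k: "k \<le> Suc n" "(w, v) \<in> adj E ^^ k" by (auto simp: B_def)
    show "w \<in> B n \<union> (\<Union>u\<in>B n. {w. {w, u} \<in> E})"
    proof (cases k)
      case 0
      then have "w \<in> B n" using k(2) unfolding B_def by (intro CollectI exI[of _ 0]) simp
      then show ?thesis by blast
    next
      case (Suc j)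
      then obtain u where "{w, u} \<in> E" "(u, v) \<in> adj E ^^ j"
        using relpow_Suc_D2[of w v j "adj E"] k(2) by (auto simp: adj_def)
      moreover have "j \<le> n" using Suc k(1) by simp
      ultimately have "u \<in> B n" "{w, u} \<in> E" by (auto simp: B_def)
      then show ?thesis by blast
    qed
  qed
  have fin: "finite (\<Union>u\<in>B n. {w. {w, u} \<in> E})"
    by (intro finite_UN_I IH card_neighbours(1)[OF valence] B)
  have "card (\<Union>u\<in>B n. {w. {w, u} \<in> E}) \<le> (\<Sum>u\<in>B n. card {w. {w, u} \<in> E})"
    by (rule card_UN_le[OF IH(1)])
  also have "\<dots> \<le> (\<Sum>u\<in>B n. l)"
  proof (rule sum_mono)
    fix u assume "u \<in> B n"
    then have "u \<in> V" by (rule B)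
    then show "card {w. {w, u} \<in> E} \<le> l" by (intro card_neighbours(2)[OF valence])
  qed
  finally have c: "card (\<Union>u\<in>B n. {w. {w, u} \<in> E}) \<le> card (B n) * l" by simp
  have "card (B (Suc n)) \<le> card (B n \<union> (\<Union>u\<in>B n. {w. {w, u} \<in> E}))"
    by (rule card_mono[OF _ sub]) (simp add: fin IH)
  also have "\<dots> \<le> card (B n) + card (\<Union>u\<in>B n. {w. {w, u} \<in> E})" by (rule card_Un_le)
  also have "\<dots> \<le> card (B n) * (l + 1)" using c by (simp add: algebra_simps)
  also have "\<dots> \<le> (l + 1) ^ n * (l + 1)" using IH(2) by (rule mult_right_mono) simp
  finally have "card (B (Suc n)) \<le> (l + 1) ^ Suc n" by (simp add: mult.commute)
  moreover have "finite (B (Suc n))" by (rule finite_subset[OF sub]) (simp add: fin IH)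
  ultimately show ?case by (simp add: B_def)
qed simp

text \<open>
  The radius is \<open>2 * R\<close> since for a point entering \<open>beyond v\<close> it is the image under \<open>g\<close> that is
  within \<open>R\<close> of \<open>v\<close>. What matters is that the bound does not depend on \<open>v\<close>.
\<close>

lemma few_crossings:
  fixes \<phi> :: "'a \<Rightarrow> 'v"
  assumes fibre: "\<And>v. v \<in> V \<Longrightarrow> finite {x \<in> X. \<phi> x = v} \<and> card {x \<in> X. \<phi> x = v} \<le> q"
    and near: "\<And>x. x \<in> X \<Longrightarrow> \<exists>n\<le>R. (\<phi> x, \<phi> (g x)) \<in> adj E ^^ n"
    and v: "v \<in> V" and \<phi>: "\<phi> \<in> X \<rightarrow> V"
  defines "D \<equiv> {x \<in> X. (\<phi> x \<in> beyond v) \<noteq> (\<phi> (g x) \<in> beyond v)}"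
  shows "finite D \<and> card D \<le> (l + 1) ^ (2 * R) * q"
proof -
  define B where "B = {w. \<exists>k\<le>2 * R. (w, v) \<in> adj E ^^ k}"
  have ball: "finite B" "card B \<le> (l + 1) ^ (2 * R)"
    using card_ball[OF v, of "2 * R"] by (auto simp: B_def)
  have close: "\<phi> x \<in> B" if x: "x \<in> D" for x
  proof -
    have xX: "x \<in> X" using x by (simp add: D_def)
    obtain n where n: "n \<le> R" "(\<phi> x, \<phi> (g x)) \<in> adj E ^^ n" using near[OF xX] by blast
    show ?thesis
    proof (cases "\<phi> x \<in> beyond v")
      case True
      then have "\<phi> (g x) \<notin> beyond v" using x by (simp add: D_def)
      then obtain k where "k \<le> n" "(\<phi> x, v) \<in> adj E ^^ k"
        using leaving_beyond[OF n(2) True] by blast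
      moreover have "k \<le> 2 * R" using \<open>k \<le> n\<close> n(1) by simp
      ultimately show ?thesis unfolding B_def by blast
    next
      case False
      then have "\<phi> (g x) \<in> beyond v" using x by (simp add: D_def)
      then obtain k where "k \<le> n" "(\<phi> (g x), v) \<in> adj E ^^ k"
        using leaving_beyond[OF relpow_adj_sym[OF n(2)] _ False] by blast
      then have "(\<phi> x, v) \<in> adj E ^^ (n + k)" "n + k \<le> 2 * R"
        using n by (auto simp: relpow_add)
      then show ?thesis unfolding B_def by blast
    qed
  qed
  have sub: "D \<subseteq> (\<Union>w\<in>B \<inter> V. {x \<in> X. \<phi> x = w})"
  proof
    fix x assume x: "x \<in> D"
    then have "x \<in> X" by (simp add: D_def)
    then show "x \<in> (\<Union>w\<in>B \<inter> V. {x \<in> X. \<phi> x = w})" using close[OF x] \<phi> by auto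
  qed
  have fin: "finite (\<Union>w\<in>B \<inter> V. {x \<in> X. \<phi> x = w})"
    using ball(1) fibre by (intro finite_UN_I) auto
  have "card D \<le> card (\<Union>w\<in>B \<inter> V. {x \<in> X. \<phi> x = w})" using sub fin by (rule card_mono[rotated])
  also have "\<dots> \<le> (\<Sum>w\<in>B \<inter> V. card {x \<in> X. \<phi> x = w})" using ball(1) by (intro card_UN_le) simp
  also have "\<dots> \<le> (\<Sum>w\<in>B \<inter> V. q)" using fibre by (intro sum_mono) blast
  also have "\<dots> = card (B \<inter> V) * q" by simp
  also have "\<dots> \<le> (l + 1) ^ (2 * R) * q"
    using ball card_mono[of B "B \<inter> V"] by (intro mult_right_mono) auto
  finally show ?thesis using finite_subset[OF sub fin] by simp
qed

text \<open>
  If \<open>Y\<close> were larger, the vertices \<open>v\<close> with at most \<open>M\<close> points of \<open>Y\<close> outside \<open>beyond v\<close> would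
  include the root, and there would be finitely many of them, as each has one of \<open>M + 1\<close> chosen
  points of \<open>Y\<close> beyond it. At one with minimal \<open>beyond v\<close>, each branch holds at most \<open>M\<close> points,
  so that the at most \<open>l\<close> branches, the fibre over \<open>v\<close> and the outside account for all of \<open>Y\<close>.
\<close>

lemma one_sided_imp_small:
  fixes \<phi> :: "'a \<Rightarrow> 'v"
  assumes \<phi>: "\<phi> \<in> Y \<rightarrow> V"
    and fibre: "\<And>v. v \<in> V \<Longrightarrow> finite {x \<in> Y. \<phi> x = v} \<and> card {x \<in> Y. \<phi> x = v} \<le> q"
    and side: "\<And>v. v \<in> V \<Longrightarrow>
      finite {x \<in> Y. \<phi> x \<in> beyond v} \<and> card {x \<in> Y. \<phi> x \<in> beyond v} \<le> M \<or>
      finite {x \<in> Y. \<phi> x \<notin> beyond v} \<and> card {x \<in> Y. \<phi> x \<notin> beyond v} \<le> M"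
  shows "finite Y \<and> card Y \<le> M + q + l * M"
proof (rule ccontr)
  assume big: "\<not> ?thesis"
  define G where "G = {v \<in> V. finite {x \<in> Y. \<phi> x \<notin> beyond v} \<and> card {x \<in> Y. \<phi> x \<notin> beyond v} \<le> M}"
  have none: "{x \<in> Y. \<phi> x \<notin> beyond z} = {}" using \<phi> by (auto simp: beyond_root)
  have zG: "z \<in> G" unfolding G_def mem_Collect_eq none using z by simp
  obtain Y0 where Y0: "Y0 \<subseteq> Y" "finite Y0" "card Y0 = Suc M"
  proof (cases "finite Y")
    case True
    then have "Suc M \<le> card Y" using big by linarith
    then show thesis using obtain_subset_with_card_n that by metis
  next
    case False
    then show thesis using infinite_arbitrarily_large that by metis
  qed
  have "G \<subseteq> (\<Union>y\<in>Y0. {v. \<phi> y \<in> beyond v})"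
  proof
    fix v assume v: "v \<in> G"
    then have vf: "finite {x \<in> Y. \<phi> x \<notin> beyond v}" "card {x \<in> Y. \<phi> x \<notin> beyond v} \<le> M"
      by (auto simp: G_def)
    have "\<not> Y0 \<subseteq> {x \<in> Y. \<phi> x \<notin> beyond v}"
    proof
      assume "Y0 \<subseteq> {x \<in> Y. \<phi> x \<notin> beyond v}"
      then have "card Y0 \<le> card {x \<in> Y. \<phi> x \<notin> beyond v}" by (rule card_mono[OF vf(1)])
      then show False using vf(2) Y0(3) by linarith
    qed
    then show "v \<in> (\<Union>y\<in>Y0. {v. \<phi> y \<in> beyond v})" using Y0(1) by blast
  qed
  moreover have "finite (\<Union>y\<in>Y0. {v. \<phi> y \<in> beyond v})"
    using Y0 \<phi> by (intro finite_UN_I finite_above) auto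
  ultimately have "finite (beyond ` G)" by (intro finite_imageI) (rule finite_subset)
  moreover have "beyond ` G \<noteq> {}" using zG by blast
  ultimately have "\<exists>A\<in>beyond ` G. \<forall>B\<in>beyond ` G. B \<le> A \<longrightarrow> A = B"
    by (rule finite_has_minimal)
  then obtain v where v: "v \<in> G" and v_min: "\<forall>B\<in>beyond ` G. B \<le> beyond v \<longrightarrow> beyond v = B"
    by (elim bexE imageE) simp
  have min: "\<not> beyond c \<subset> beyond v" if "c \<in> G" for c
    using v_min that by (auto simp: psubset_eq)
  have vV: "v \<in> V" using v by (simp add: G_def)
  define N where "N = {c. {c, v} \<in> E \<and> beyond c \<subset> beyond v}"
  note nb = card_neighbours[OF valence[OF vV]]
  have Nsub: "N \<subseteq> {w. {w, v} \<in> E}" by (auto simp: N_def)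
  have N: "finite N" "card N \<le> l"
    using finite_subset[OF Nsub nb(1)] card_mono[OF nb(1) Nsub] nb(2) by auto
  have NV: "c \<in> V" if "c \<in> N" for c using that edge_in_V by (auto simp: N_def)
  have small: "finite {x \<in> Y. \<phi> x \<in> beyond c} \<and> card {x \<in> Y. \<phi> x \<in> beyond c} \<le> M" if c: "c \<in> N" for c
    using side[OF NV[OF c]] min[of c] c NV[OF c] by (auto simp: G_def N_def)
  let ?F = "{x \<in> Y. \<phi> x = v}" and ?U = "\<Union>c\<in>N. {x \<in> Y. \<phi> x \<in> beyond c}"
    and ?W = "{x \<in> Y. \<phi> x \<notin> beyond v}"
  have Y: "Y \<subseteq> ?W \<union> (?F \<union> ?U)"
  proof
    fix x assume x: "x \<in> Y"
    show "x \<in> ?W \<union> (?F \<union> ?U)"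
    proof (cases "\<phi> x \<in> beyond v \<and> \<phi> x \<noteq> v")
      case True
      then obtain c where "{v, c} \<in> E" "\<phi> x \<in> beyond c" "beyond c \<subset> beyond v"
        using beyond_step[OF _ _ vV, of "\<phi> x"] by metis
      then have "c \<in> N" "\<phi> x \<in> beyond c" by (simp_all add: N_def insert_commute)
      then show ?thesis using x by blast
    qed (use x in auto)
  qed
  have W: "finite ?W" "card ?W \<le> M" using v by (auto simp: G_def)
  have F: "finite ?F" "card ?F \<le> q" using fibre[OF vV] by auto
  have "card ?U \<le> (\<Sum>c\<in>N. card {x \<in> Y. \<phi> x \<in> beyond c})" by (rule card_UN_le[OF N(1)])
  also have "\<dots> \<le> (\<Sum>c\<in>N. M)" using small by (intro sum_mono) blast
  also have "\<dots> \<le> l * M" using N by simp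
  finally have U: "card ?U \<le> l * M" .
  have finU: "finite ?U" using N(1) small by (intro finite_UN_I) auto
  have fin: "finite (?W \<union> (?F \<union> ?U))" using W F finU by simp
  have "card Y \<le> card (?W \<union> (?F \<union> ?U))" by (rule card_mono[OF fin Y])
  also have "\<dots> \<le> card ?W + (card ?F + card ?U)"
    using card_Un_le[of ?W "?F \<union> ?U"] card_Un_le[of ?F ?U] by linarith
  finally show False using big finite_subset[OF Y fin] W F U by linarith
qed

end

section \<open>Rounding points of the realization to vertices\<close>

lemma pl_length_nonneg: "0 \<le> pl_length ps"
  by (auto simp: pl_length_def edge_dist_def intro!: sum_nonneg)

lemma path_metric_le: "pl_path V E p q ps \<Longrightarrow> path_metric V E p q \<le> pl_length ps"
  unfolding path_metric_def
  by (intro cInf_lower bdd_belowI[of _ 0]) (auto simp: pl_length_nonneg)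

definition vertex_point :: "'v \<Rightarrow> 'v \<Rightarrow> real" where
  "vertex_point v = (\<lambda>w. if w = v then 1 else 0)"

lemma supp_vertex_point: "supp (vertex_point v) = {v}"
  by (auto simp: supp_def vertex_point_def)

lemma vertex_point_in: "v \<in> V \<Longrightarrow> vertex_point v \<in> realization V E"
  by (auto simp: realization_def supp_vertex_point) (auto simp: vertex_point_def)

lemma supp_singleton_eq_vertex_point:
  "p \<in> realization V E \<Longrightarrow> supp p = {v} \<Longrightarrow> p = vertex_point v"
  by (auto simp: realization_def supp_def vertex_point_def fun_eq_iff)

lemma pl_path_single: "p \<in> realization V E \<Longrightarrow> pl_path V E p p [p]"
  by (simp add: pl_path_def)

lemma pl_path_snoc:
  assumes "pl_path V E p q ps" "r \<in> realization V E" "e \<in> E" "supp q \<subseteq> e" "supp r \<subseteq> e"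
  shows "pl_path V E p r (ps @ [r])"
  using assms by (auto simp: pl_path_def successively_append_iff hd_append)

context rooted_tree
begin

lemma edge_cases:
  assumes "e \<in> E"
  obtains a b where "a \<in> V" "b \<in> V" "a \<noteq> b" "e = {a, b}"
  using assms tree unfolding simplicial_tree_def by blast

lemma sum_on_edge:
  fixes a b :: 'v
  assumes "a \<noteq> b" "supp p \<subseteq> {a, b}"
  shows "(\<Sum>w\<in>supp p. p w * \<delta> w) = p a * \<delta> a + p b * \<delta> b"
proof -
  have "(\<Sum>w\<in>supp p. p w * \<delta> w) = (\<Sum>w\<in>{a, b}. p w * \<delta> w)"
    using assms(2) by (intro sum.mono_neutral_left) (auto simp: supp_def)
  then show ?thesis using assms(1) by simp
qed

lemma coordinates_on_edge:
  assumes "p \<in> realization V E" "a \<noteq> b" "supp p \<subseteq> {a, b}"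
  shows "p a + p b = 1" "0 \<le> p a" "0 \<le> p b"
  using sum_on_edge[OF assms(2,3), of "\<lambda>_. 1"] assms(1) by (auto simp: realization_def)

lemma edge_dist_on_edge:
  fixes a b :: 'v
  assumes "a \<noteq> b" "supp p \<subseteq> {a, b}" "supp r \<subseteq> {a, b}"
  shows "edge_dist p r = (\<bar>p a - r a\<bar> + \<bar>p b - r b\<bar>) / 2"
proof -
  have "(\<Sum>v\<in>supp p \<union> supp r. \<bar>p v - r v\<bar>) = (\<Sum>v\<in>{a, b}. \<bar>p v - r v\<bar>)"
    using assms(2,3) by (intro sum.mono_neutral_left) (auto simp: supp_def)
  then show ?thesis using assms(1) by (simp add: edge_dist_def)
qed

lemma ex_nearest_vertex:
  assumes "p \<in> realization V E"
  shows "\<exists>v\<in>V. 1 / 2 \<le> p v"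
proof (cases "\<exists>v\<in>V. supp p = {v}")
  case True
  then show ?thesis
    using supp_singleton_eq_vertex_point[OF assms] by (auto simp: vertex_point_def)
next
  case False
  then have "supp p \<in> E" using assms by (simp add: realization_def)
  then obtain a b where ab: "a \<in> V" "b \<in> V" "a \<noteq> b" "supp p = {a, b}" by (rule edge_cases)
  then have "p a + p b = 1" using coordinates_on_edge(1)[OF assms ab(3)] by simp
  then have "1 / 2 \<le> p a \<or> 1 / 2 \<le> p b" by linarith
  then show ?thesis using ab by blast
qed

definition nearest :: "('v \<Rightarrow> real) \<Rightarrow> 'v" where
  "nearest p = (SOME v. v \<in> V \<and> 1 / 2 \<le> p v)"

lemma nearest:
  assumes "p \<in> realization V E"
  shows "nearest p \<in> V" "1 / 2 \<le> p (nearest p)"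
  using someI_ex[of "\<lambda>v. v \<in> V \<and> 1 / 2 \<le> p v"] ex_nearest_vertex[OF assms]
  unfolding nearest_def by blast+

lemma edge_to_vertex:
  assumes p: "p \<in> realization V E" and v: "1 / 2 \<le> p v"
    and neq: "p \<noteq> vertex_point v"
  shows "supp p \<in> E" "v \<in> supp p"
    and "edge_dist p (vertex_point v) \<le> 1 / 2" "edge_dist (vertex_point v) p \<le> 1 / 2"
proof -
  show vp: "v \<in> supp p" using v by (auto simp: supp_def)
  show e: "supp p \<in> E"
    using p vp neq supp_singleton_eq_vertex_point[OF p] by (auto simp: realization_def)
  obtain a b where ab: "a \<noteq> b" "supp p = {a, b}" using e by (rule edge_cases)
  obtain u where u: "u \<noteq> v" "supp p = {u, v}"
  proof (cases "v = a")
    case True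
    show thesis by (rule that[of b]) (use True ab in auto)
  next
    case False
    show thesis by (rule that[of a]) (use False ab vp in auto)
  qed
  then have "p u + p v = 1" "0 \<le> p u" "0 \<le> p v" using coordinates_on_edge[OF p u(1)] by auto
  moreover have "supp p \<subseteq> {u, v}" "supp (vertex_point v) \<subseteq> {u, v}"
    using u by (auto simp: supp_vertex_point)
  ultimately show "edge_dist p (vertex_point v) \<le> 1 / 2" "edge_dist (vertex_point v) p \<le> 1 / 2"
    using v u(1) by (auto simp: edge_dist_on_edge[OF u(1)] vertex_point_def)
qed

text \<open>
  Both points are within \<open>1 / 2\<close> of their common nearest vertex. If they are the images of \<open>x\<close>
  and \<open>y\<close>, the lower coarse inequality makes \<open>d x y\<close> at most \<open>m ^ 2 + m\<close>, which bounds the fibres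
  of the rounding.
\<close>

lemma path_metric_same_nearest:
  assumes p: "p \<in> realization V E" and r: "r \<in> realization V E" and eq: "nearest p = nearest r"
  shows "path_metric V E p r \<le> 1"
proof -
  define v where "v = nearest p"
  have v: "v \<in> V" "1 / 2 \<le> p v" "1 / 2 \<le> r v"
    using nearest[OF p] nearest[OF r] eq by (auto simp: v_def)
  have len2: "pl_length [a, b] = edge_dist a b" for a b :: "'v \<Rightarrow> real"
    by (simp add: pl_length_def)
  have len3: "pl_length [a, b, c] = edge_dist a b + edge_dist b c" for a b c :: "'v \<Rightarrow> real"
    by (simp add: pl_length_def numeral_2_eq_2)
  have bound: "path_metric V E p r \<le> 1" if "pl_path V E p r ps" "pl_length ps \<le> 1" for ps
    using path_metric_le[OF that(1)] that(2) by linarith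
  let ?v = "vertex_point v"
  note vp = vertex_point_in[OF v(1), of E]
  note single = pl_path_single[of _ V E]
  show ?thesis
  proof (cases "p = ?v")
    case pv: True
    show ?thesis
    proof (cases "r = ?v")
      case True
      then show ?thesis using bound[of "[p]"] single[OF p] pv by (simp add: pl_length_def)
    next
      case False
      note e = edge_to_vertex[OF r v(3) False]
      have "pl_path V E p r ([p] @ [r])"
        using pl_path_snoc[OF single[OF p] r e(1)] e(2) pv by (simp add: supp_vertex_point)
      then show ?thesis using bound[of "[p, r]"] e(4) pv by (simp add: len2)
    qed
  next
    case False
    note ep = edge_to_vertex[OF p v(2) False]
    have path: "pl_path V E p ?v ([p] @ [?v])"
      using pl_path_snoc[OF single[OF p] vp ep(1)] ep(2) by (simp add: supp_vertex_point)
    show ?thesis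
    proof (cases "r = ?v")
      case True
      then show ?thesis using bound[of "[p, r]"] path ep(3) by (simp add: len2)
    next
      case False
      note e = edge_to_vertex[OF r v(3) False]
      have "pl_path V E p r (([p] @ [?v]) @ [r])"
        using pl_path_snoc[OF path r e(1)] e(2) by (simp add: supp_vertex_point)
      then show ?thesis using bound[of "[p, ?v, r]"] e(4) ep(3) by (simp add: len3)
    qed
  qed
qed

text \<open>
  Without such a path, the infimum in the path metric would range over the empty set and carry
  no information.
\<close>

lemma ex_pl_path:
  assumes p: "p \<in> realization V E" and r: "r \<in> realization V E"
  shows "\<exists>ps. pl_path V E p r ps"
proof -
  note np = nearest[OF p] and nr = nearest[OF r]
  have start: "\<exists>ps. pl_path V E p (vertex_point (nearest p)) ps"
  proof (cases "p = vertex_point (nearest p)")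
    case True
    then show ?thesis using pl_path_single[OF p] by metis
  next
    case False
    note e = edge_to_vertex[OF p np(2) False]
    show ?thesis
      using pl_path_snoc[OF pl_path_single[OF p] vertex_point_in[OF np(1)] e(1)] e(2)
      by (auto simp: supp_vertex_point)
  qed
  have "(nearest p, nearest r) \<in> {(x, y). {x, y} \<in> E}\<^sup>*" by (rule connected[OF np(1) nr(1)])
  then have "\<exists>ps. pl_path V E p (vertex_point (nearest r)) ps"
  proof (induction rule: rtrancl_induct)
    case base
    show ?case by (rule start)
  next
    case (step y w)
    then obtain ps where ps: "pl_path V E p (vertex_point y) ps" by blast
    have yw: "{y, w} \<in> E" using step by simp
    have "pl_path V E p (vertex_point w) (ps @ [vertex_point w])"
      using pl_path_snoc[OF ps vertex_point_in yw] edge_in_V[OF yw] by (simp add: supp_vertex_point)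
    then show ?case by blast
  qed
  then obtain ps where ps: "pl_path V E p (vertex_point (nearest r)) ps" by blast
  show ?thesis
  proof (cases "r = vertex_point (nearest r)")
    case True
    then show ?thesis using ps by metis
  next
    case False
    note e = edge_to_vertex[OF r nr(2) False]
    show ?thesis using pl_path_snoc[OF ps r e(1)] e(2) by (auto simp: supp_vertex_point)
  qed
qed

text \<open>
  The affine extension of a function on the vertices to the realization.
\<close>

definition extend :: "('v \<Rightarrow> real) \<Rightarrow> ('v \<Rightarrow> real) \<Rightarrow> real" where
  "extend \<delta> p = (\<Sum>w\<in>supp p. p w * \<delta> w)"

text \<open>
  On an edge \<open>{a, b}\<close> the extension is affine with slope \<open>\<delta> a - \<delta> b\<close>, which is at most \<open>1\<close> in
  absolute value: the hypothesis applies to \<open>(a, b)\<close> and to \<open>(b, a)\<close>.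
\<close>

lemma extend_edge:
  assumes \<delta>: "\<And>a b. {a, b} \<in> E \<Longrightarrow> \<delta> b \<le> \<delta> a + 1"
    and p: "p \<in> realization V E" and r: "r \<in> realization V E"
    and e: "e \<in> E" "supp p \<subseteq> e" "supp r \<subseteq> e"
  shows "extend \<delta> r - extend \<delta> p \<le> edge_dist p r"
proof -
  obtain a b where ab: "a \<noteq> b" "e = {a, b}" using e(1) by (rule edge_cases)
  have sup: "supp p \<subseteq> {a, b}" "supp r \<subseteq> {a, b}" using e ab by auto
  have pb: "p b = 1 - p a" and rb: "r b = 1 - r a"
    using coordinates_on_edge(1)[OF p ab(1) sup(1)] coordinates_on_edge(1)[OF r ab(1) sup(2)] by auto
  have "edge_dist p r = \<bar>r a - p a\<bar>"
    unfolding edge_dist_on_edge[OF ab(1) sup] pb rb by (simp add: abs_minus_commute)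
  moreover have "extend \<delta> r - extend \<delta> p = (r a - p a) * (\<delta> a - \<delta> b)"
    unfolding extend_def sum_on_edge[OF ab(1) sup(1)] sum_on_edge[OF ab(1) sup(2)] pb rb
    by (simp add: algebra_simps)
  moreover have "\<bar>\<delta> a - \<delta> b\<bar> \<le> 1"
    using \<delta>[of a b] \<delta>[of b a] e(1) ab(2) by (simp add: insert_commute abs_le_iff)
  then have "\<bar>(r a - p a) * (\<delta> a - \<delta> b)\<bar> \<le> \<bar>r a - p a\<bar>"
    unfolding abs_mult by (rule mult_left_le) simp
  ultimately show ?thesis by linarith
qed

lemma extend_le_pl_length:
  assumes \<delta>: "\<And>a b. {a, b} \<in> E \<Longrightarrow> \<delta> b \<le> \<delta> a + 1"
    and ps: "pl_path V E p r ps"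
  shows "extend \<delta> r - extend \<delta> p \<le> pl_length ps"
proof -
  let ?n = "length ps - 1"
  have ne: "ps \<noteq> []" using ps by (simp add: pl_path_def)
  have "extend \<delta> r - extend \<delta> p = extend \<delta> (ps ! ?n) - extend \<delta> (ps ! 0)"
    using ps ne by (auto simp: pl_path_def hd_conv_nth last_conv_nth)
  also have "\<dots> = (\<Sum>i<?n. extend \<delta> (ps ! Suc i) - extend \<delta> (ps ! i))"
    by (rule sum_lessThan_telescope[symmetric])
  also have "\<dots> \<le> (\<Sum>i<?n. edge_dist (ps ! i) (ps ! Suc i))"
  proof (rule sum_mono)
    fix i assume "i \<in> {..<?n}"
    then have i: "Suc i < length ps" by auto
    then have "ps ! i \<in> realization V E" "ps ! Suc i \<in> realization V E"
      using ps by (auto simp: pl_path_def subset_iff)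
    moreover obtain e where "e \<in> E" "supp (ps ! i) \<subseteq> e" "supp (ps ! Suc i) \<subseteq> e"
      using ps successively_nth[OF _ i, of "\<lambda>x y. \<exists>e\<in>E. supp x \<subseteq> e \<and> supp y \<subseteq> e"]
      unfolding pl_path_def by blast
    ultimately show "extend \<delta> (ps ! Suc i) - extend \<delta> (ps ! i) \<le> edge_dist (ps ! i) (ps ! Suc i)"
      by (intro extend_edge[of \<delta>] \<delta>)
  qed
  finally show ?thesis by (simp add: pl_length_def)
qed

text \<open>
  The graph distance from the nearest vertex of \<open>p\<close>, extended to the realization, is
  1-Lipschitz along every piecewise linear path. Rounding at either end costs \<open>1 / 2\<close>.
\<close>

lemma walk_between_nearest:
  assumes p: "p \<in> realization V E" and r: "r \<in> realization V E"
    and R: "path_metric V E p r + 1 \<le> real R"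
  shows "\<exists>n\<le>R. (nearest p, nearest r) \<in> adj E ^^ n"
proof -
  define v where "v = nearest p"
  note np = nearest[OF p, folded v_def] and nr = nearest[OF r]
  define dist where "dist w = (LEAST n. (v, w) \<in> adj E ^^ n)" for w
  have dist: "(v, w) \<in> adj E ^^ dist w" if "w \<in> V" for w
    using connected_relpow[OF np(1) that] unfolding dist_def by (rule LeastI_ex)
  let ?\<delta> = "\<lambda>w. real (dist w)"
  have lip: "?\<delta> b \<le> ?\<delta> a + 1" if ab: "{a, b} \<in> E" for a b
  proof -
    have "(v, b) \<in> adj E ^^ Suc (dist a)"
      using dist[of a] edge_in_V[OF ab] ab by (auto simp: adj_def)
    then have "dist b \<le> Suc (dist a)" unfolding dist_def by (rule Least_le)
    then show ?thesis by simp
  qed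
  have dv: "dist v = 0" unfolding dist_def by (rule Least_equality) auto
  have near: "\<bar>extend ?\<delta> s - ?\<delta> w\<bar> \<le> 1 / 2" if s: "s \<in> realization V E" "1 / 2 \<le> s w" for s w
  proof (cases "s = vertex_point w")
    case True
    then show ?thesis by (simp add: extend_def supp_vertex_point) (simp add: vertex_point_def)
  next
    case False
    note e = edge_to_vertex[OF s False]
    have w: "w \<in> V" using e(1,2) by (metis edge_cases insertE singletonD)
    have "extend ?\<delta> (vertex_point w) = ?\<delta> w"
      by (simp add: extend_def supp_vertex_point) (simp add: vertex_point_def)
    moreover have sub: "supp (vertex_point w) \<subseteq> supp s" using e(2) by (simp add: supp_vertex_point)
    have "extend ?\<delta> (vertex_point w) - extend ?\<delta> s \<le> edge_dist s (vertex_point w)"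
      "extend ?\<delta> s - extend ?\<delta> (vertex_point w) \<le> edge_dist (vertex_point w) s"
      by (rule extend_edge[of ?\<delta>, OF lip _ _ e(1)],
          (rule s(1) vertex_point_in[OF w] subset_refl sub | assumption)+)+
    ultimately show ?thesis using e(3,4) by linarith
  qed
  have "?\<delta> (nearest r) - 1 \<le> path_metric V E p r"
    unfolding path_metric_def
  proof (rule cInf_greatest)
    show "{pl_length ps |ps. pl_path V E p r ps} \<noteq> {}" using ex_pl_path[OF p r] by blast
    fix x assume "x \<in> {pl_length ps |ps. pl_path V E p r ps}"
    then obtain ps where ps: "pl_path V E p r ps" "x = pl_length ps" by blast
    have "extend ?\<delta> r - extend ?\<delta> p \<le> pl_length ps"
      using lip ps(1) by (rule extend_le_pl_length)
    then show "?\<delta> (nearest r) - 1 \<le> x"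
      using near[OF p np(2)] near[OF r nr(2)] dv ps(2) by linarith
  qed
  then have "dist (nearest r) \<le> R" using R by simp
  then show ?thesis using dist[OF nr(1)] v_def by blast
qed

end

section \<open>Elements with deep roots are torsion\<close>

text \<open>
  Every point is periodic with a period of at most \<open>M\<close>, hence a divisor of \<open>fact M\<close>.
\<close>

lemma small_orbits_imp_finite_order:
  assumes h: "h \<in> X \<rightarrow> X" "inj_on h X"
    and small: "\<And>x. x \<in> X \<Longrightarrow> finite (range (\<lambda>k. (h ^^ k) x)) \<and> card (range (\<lambda>k. (h ^^ k) x)) \<le> M"
    and x: "x \<in> X"
  shows "(h ^^ fact M) x = x"
proof -
  have "\<not> inj_on (\<lambda>k. (h ^^ k) x) {..M}"
  proof
    assume "inj_on (\<lambda>k. (h ^^ k) x) {..M}"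
    then have "card {..M} = card ((\<lambda>k. (h ^^ k) x) ` {..M})" by (simp add: card_image)
    also have "\<dots> \<le> card (range (\<lambda>k. (h ^^ k) x))" using small[OF x] by (intro card_mono) auto
    finally show False using small[OF x] by simp
  qed
  then obtain s t where st: "s < t" "t \<le> M" "(h ^^ s) x = (h ^^ t) x"
    unfolding inj_on_def by (metis atMost_iff linorder_neqE_nat)
  let ?p = "t - s"
  have "(h ^^ s) ((h ^^ ?p) x) = (h ^^ s) x"
  proof -
    have "(h ^^ s) ((h ^^ ?p) x) = (h ^^ (s + ?p)) x" by (simp only: funpow_add o_apply)
    then show ?thesis using st by simp
  qed
  then have p: "(h ^^ ?p) x = x"
    using inj_on_funpow_on[OF h, of s] funpow_in[OF h(1) x] x by (simp add: inj_on_def)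
  have "?p dvd fact M" using st by (intro dvd_fact) auto
  then obtain c where c: "fact M = ?p * c" by (rule dvdE)
  have "(h ^^ (?p * c)) x = x"
  proof (induction c)
    case (Suc c)
    have "(h ^^ (?p * Suc c)) x = (h ^^ (?p * c + ?p)) x" by (simp add: add.commute)
    also have "\<dots> = (h ^^ (?p * c)) ((h ^^ ?p) x)" by (simp only: funpow_add o_apply)
    finally show ?case using Suc.IH p by simp
  qed simp
  then show ?thesis using c by simp
qed

text \<open>
  The bound for \<open>N\<close> involves only the displacement \<open>S\<close> of the power \<open>h ^^ N\<close>. The displacement
  \<open>R\<close> of \<open>h\<close> may be much larger; it enters only the size of the orbits.
\<close>

lemma (in bounded_valence_tree) deep_root_imp_finite_order:
  fixes \<phi> :: "'a \<Rightarrow> 'v"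
  assumes \<phi>: "\<phi> \<in> X \<rightarrow> V"
    and fibre: "\<And>v. v \<in> V \<Longrightarrow> finite {x \<in> X. \<phi> x = v} \<and> card {x \<in> X. \<phi> x = v} \<le> q"
    and h: "h \<in> X \<rightarrow> X" "inj_on h X"
    and near: "\<And>x. x \<in> X \<Longrightarrow> \<exists>n\<le>R. (\<phi> x, \<phi> (h x)) \<in> adj E ^^ n"
    and nearN: "\<And>x. x \<in> X \<Longrightarrow> \<exists>n\<le>S. (\<phi> x, \<phi> ((h ^^ N) x)) \<in> adj E ^^ n"
    and deep: "(l + 1) ^ (2 * S) * q < N"
  shows "\<exists>k>0. \<forall>x\<in>X. (h ^^ k) x = x"
proof -
  define C where "C = (l + 1) ^ (2 * R) * q"
  define M where "M = N * C + q + l * (N * C)"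
  have small: "finite (range (\<lambda>k. (h ^^ k) x)) \<and> card (range (\<lambda>k. (h ^^ k) x)) \<le> M"
    if x: "x \<in> X" for x
    unfolding M_def
  proof (rule one_sided_imp_small)
    let ?Y = "range (\<lambda>k. (h ^^ k) x)"
    have YX: "?Y \<subseteq> X" using funpow_in[OF h(1) x] by auto
    show "\<phi> \<in> ?Y \<rightarrow> V" using YX \<phi> by blast
    show "finite {y \<in> ?Y. \<phi> y = v} \<and> card {y \<in> ?Y. \<phi> y = v} \<le> q" if v: "v \<in> V" for v
    proof -
      have sub: "{y \<in> ?Y. \<phi> y = v} \<subseteq> {x \<in> X. \<phi> x = v}" using YX by blast
      then show ?thesis
        using fibre[OF v] card_mono[OF _ sub] finite_subset[OF sub] by linarith
    qed
    show "finite {y \<in> ?Y. \<phi> y \<in> beyond v} \<and> card {y \<in> ?Y. \<phi> y \<in> beyond v} \<le> N * C \<or>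
        finite {y \<in> ?Y. \<phi> y \<notin> beyond v} \<and> card {y \<in> ?Y. \<phi> y \<notin> beyond v} \<le> N * C"
      if v: "v \<in> V" for v
    proof -
      have D: "finite {x \<in> X. (\<phi> x \<in> beyond v) \<noteq> (\<phi> (h x) \<in> beyond v)}"
        "card {x \<in> X. (\<phi> x \<in> beyond v) \<noteq> (\<phi> (h x) \<in> beyond v)} \<le> C"
        using few_crossings[OF fibre near v \<phi>] by (auto simp: C_def)
      have DN: "finite {x \<in> X. (\<phi> x \<in> beyond v) \<noteq> (\<phi> ((h ^^ N) x) \<in> beyond v)}"
        "card {x \<in> X. (\<phi> x \<in> beyond v) \<noteq> (\<phi> ((h ^^ N) x) \<in> beyond v)} < N"
        using few_crossings[of X \<phi> q S "h ^^ N", OF fibre nearN v \<phi>] deep by auto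
      have sets: "?Y \<inter> {x. \<phi> x \<in> beyond v} = {y \<in> ?Y. \<phi> y \<in> beyond v}"
        "?Y - {x. \<phi> x \<in> beyond v} = {y \<in> ?Y. \<phi> y \<notin> beyond v}" by blast+
      show ?thesis
        using orbit_on_one_side[OF h x, of "{x. \<phi> x \<in> beyond v}" C N, unfolded mem_Collect_eq,
          OF D DN] unfolding sets .
    qed
  qed
  show ?thesis
    using small_orbits_imp_finite_order[OF h small] by (intro exI[of _ "fact M"]) auto
qed

lemma one_Bd: "\<one>\<^bsub>Bd X d\<^esub> = (\<lambda>x\<in>X. x)"
  by (simp add: Bd_def one_Sym)

lemma Bd_pow_apply:
  assumes X: "Metric_space X d" and h: "h \<in> carrier (Bd X d)" and x: "x \<in> X"
  shows "(h [^]\<^bsub>Bd X d\<^esub> (k::nat)) x = (h ^^ k) x"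
proof (induction k)
  case 0
  then show ?case using x by (simp add: one_Bd)
next
  case (Suc k)
  interpret group "Bd X d" by (rule group_Bd[OF X])
  have Bij: "g \<in> Bij X" if "g \<in> carrier (Bd X d)" for g
    using that by (simp add: Bd_def bounded_displacement_def carrier_Sym)
  have "h [^]\<^bsub>Bd X d\<^esub> Suc k = h [^]\<^bsub>Bd X d\<^esub> k \<otimes>\<^bsub>Sym X\<^esub> h"
    by (simp add: Bd_def)
  also have "\<dots> = (\<lambda>x\<in>X. h ((h [^]\<^bsub>Bd X d\<^esub> k) x))"
    using h by (intro mult_Sym Bij nat_pow_closed)
  finally show ?case using x Suc.IH by simp
qed

lemma dyadicI: "of_int a / 2 ^ n \<in> carrier dyadic_group"
  by (auto simp: dyadic_group_def)

lemma zero_dyadic: "0 \<in> carrier dyadic_group"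
  using dyadicI[of 0 0] by simp

lemma dyadic_embedding_power:
  assumes X: "Metric_space X d" and H: "subgroup H (Bd X d)"
    and \<psi>: "\<psi> \<in> hom dyadic_group ((Bd X d)\<lparr>carrier := H\<rparr>)"
    and a: "a \<in> carrier dyadic_group"
  shows "\<psi> (of_nat k * a) = \<psi> a [^]\<^bsub>Bd X d\<^esub> k"
proof -
  interpret group "Bd X d" by (rule group_Bd[OF X])
  have add: "b + c \<in> carrier dyadic_group"
    if b: "b \<in> carrier dyadic_group" and c: "c \<in> carrier dyadic_group" for b c
  proof -
    obtain i m where b: "b = of_int i / 2 ^ m" using b by (auto simp: dyadic_group_def)
    obtain j n where c: "c = of_int j / 2 ^ n" using c by (auto simp: dyadic_group_def)
    have "b + c = of_int (i * 2 ^ n + j * 2 ^ m) / 2 ^ (m + n)"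
      unfolding b c by (simp add: field_simps power_add)
    then show ?thesis by (simp only: dyadicI)
  qed
  note zero = zero_dyadic
  have mult: "\<psi> (b + c) = \<psi> b \<otimes>\<^bsub>Bd X d\<^esub> \<psi> c"
    if "b \<in> carrier dyadic_group" "c \<in> carrier dyadic_group" for b c
    using hom_mult[OF \<psi> that] by (simp add: dyadic_group_def)
  have closed: "\<psi> b \<in> carrier (Bd X d)" if "b \<in> carrier dyadic_group" for b
    using hom_in_carrier[OF \<psi> that] subgroup.subset[OF H] by auto
  have mem: "of_nat k * a \<in> carrier dyadic_group" for k
    by (induction k) (use zero add a in \<open>auto simp: algebra_simps\<close>)
  show ?thesis
  proof (induction k)
    case 0
    have "\<psi> 0 \<otimes>\<^bsub>Bd X d\<^esub> \<psi> 0 = \<psi> 0" using mult[OF zero zero] by simp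
    then show ?case using closed[OF zero] by simp
  next
    case (Suc k)
    have "\<psi> (of_nat (Suc k) * a) = \<psi> (of_nat k * a + a)" by (simp add: algebra_simps)
    also have "\<dots> = \<psi> (of_nat k * a) \<otimes>\<^bsub>Bd X d\<^esub> \<psi> a" by (rule mult[OF mem a])
    finally show ?case using Suc.IH by simp
  qed
qed

theorem theorem1:
  fixes X :: "'a set" and d :: "'a \<Rightarrow> 'a \<Rightarrow> real"
    and V :: "'v set" and E :: "'v set set"
    and f :: "'a \<Rightarrow> ('v \<Rightarrow> real)"
    and l m q :: nat
  assumes "Metric_space X d"
    and "simplicial_tree V E"
    and "f \<in> X \<rightarrow> realization V E"
    and "0 < l" and "0 < m" and "0 < q"
    and "\<forall>v\<in>V. finite {e \<in> E. v \<in> e} \<and> card {e \<in> E. v \<in> e} \<le> l"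
    and "\<forall>x\<in>X. finite (Metric_space.mcball X d x (real (m^2 + m))) \<and>
           card (Metric_space.mcball X d x (real (m^2 + m))) \<le> q"
    and "\<forall>x\<in>X. \<forall>y\<in>X. 1 / real m * d x y - real m \<le> path_metric V E (f x) (f y) \<and>
           path_metric V E (f x) (f y) \<le> real m * d x y + real m"
  shows "\<not> (\<exists>H. subgroup H (Bd X d) \<and> dyadic_group \<cong> (Bd X d)\<lparr>carrier := H\<rparr>)"
proof
  assume "\<exists>H. subgroup H (Bd X d) \<and> dyadic_group \<cong> (Bd X d)\<lparr>carrier := H\<rparr>"
  then obtain H \<psi> where H: "subgroup H (Bd X d)"
    and "\<psi> \<in> iso dyadic_group ((Bd X d)\<lparr>carrier := H\<rparr>)"
    by (auto simp: is_iso_def)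
  then have \<psi>: "\<psi> \<in> hom dyadic_group ((Bd X d)\<lparr>carrier := H\<rparr>)"
    and inj: "inj_on \<psi> (carrier dyadic_group)"
    by (auto simp: iso_def bij_betw_def)
  interpret Metric_space X d by fact
  obtain z where z: "z \<in> V"
    using assms(2) unfolding simplicial_tree_def graph_connected_def by blast
  interpret bounded_valence_tree V E z l
    by unfold_locales (use assms(2,7) z in auto)
  have fX: "f x \<in> realization V E" if "x \<in> X" for x using assms(3) that by blast
  define \<phi> where "\<phi> x = nearest (f x)" for x
  have \<phi>: "\<phi> \<in> X \<rightarrow> V" using nearest(1)[OF fX] by (simp add: \<phi>_def)
  have fibre: "finite {x \<in> X. \<phi> x = v} \<and> card {x \<in> X. \<phi> x = v} \<le> q" for v
  proof (cases "{x \<in> X. \<phi> x = v} = {}")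
    case False
    then obtain x where x: "x \<in> X" "\<phi> x = v" by blast
    have sub: "{y \<in> X. \<phi> y = v} \<subseteq> mcball x (real (m^2 + m))"
    proof
      fix y assume y: "y \<in> {y \<in> X. \<phi> y = v}"
      then have "path_metric V E (f x) (f y) \<le> 1"
        using path_metric_same_nearest[OF fX fX] x by (simp add: \<phi>_def)
      moreover have "1 / real m * d x y - real m \<le> path_metric V E (f x) (f y)"
        using assms(9) x y by blast
      ultimately have "1 / real m * d x y \<le> 1 + real m" by linarith
      then have "d x y \<le> real m * (1 + real m)"
        using assms(5) by (simp add: field_simps)
      then show "y \<in> mcball x (real (m^2 + m))"
        using x y by (simp add: algebra_simps power2_eq_square)
    qed
    have "finite (mcball x (real (m^2 + m)))" "card (mcball x (real (m^2 + m))) \<le> q"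
      using assms(8) x(1) by auto
    then show ?thesis using card_mono[OF _ sub] finite_subset[OF sub] by linarith
  next
    case True
    show ?thesis unfolding True by simp
  qed
  have near: "\<exists>R. \<forall>x\<in>X. \<exists>n\<le>R. (\<phi> x, \<phi> (g x)) \<in> adj E ^^ n" if g: "g \<in> carrier (Bd X d)" for g
  proof -
    obtain r :: nat where r: "\<And>x. x \<in> X \<Longrightarrow> d x (g x) \<le> real r" and gB: "g \<in> Bij X"
      using g by (auto simp: Bd_def bounded_displacement_def carrier_Sym)
    have gX: "g x \<in> X" if "x \<in> X" for x using gB Bij_imp_funcset that by blast
    have "\<exists>n\<le>m * r + m + 1. (\<phi> x, \<phi> (g x)) \<in> adj E ^^ n" if x: "x \<in> X" for x
    proof -
      have "path_metric V E (f x) (f (g x)) \<le> real m * d x (g x) + real m"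
        using assms(9) x gX by blast
      also have "\<dots> \<le> real m * real r + real m"
        using r[OF x] by (intro add_right_mono mult_left_mono) auto
      finally show ?thesis
        unfolding \<phi>_def by (intro walk_between_nearest fX x gX) simp
    qed
    then show ?thesis by blast
  qed
  have dy: "1 / 2 ^ n \<in> carrier dyadic_group" for n
    using dyadicI[of 1 n] by simp
  have \<psi>B: "\<psi> a \<in> carrier (Bd X d)" if "a \<in> carrier dyadic_group" for a
    using hom_in_carrier[OF \<psi> that] subgroup.subset[OF H] by auto
  obtain S where S: "\<forall>x\<in>X. \<exists>n\<le>S. (\<phi> x, \<phi> (\<psi> 1 x)) \<in> adj E ^^ n"
    using near[OF \<psi>B[OF dy[of 0]]] by auto
  (* the bound on the crossings of the image of 1, which is smaller than 2 ^ n *)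
  define n where "n = (l + 1) ^ (2 * S) * q"
  define h where "h = \<psi> (1 / 2 ^ n)"
  have hB: "h \<in> carrier (Bd X d)" unfolding h_def by (rule \<psi>B[OF dy])
  have pow: "\<psi> (of_nat k * (1 / 2 ^ n)) = h [^]\<^bsub>Bd X d\<^esub> k" for k
    unfolding h_def by (rule dyadic_embedding_power[OF assms(1) H \<psi> dy])
  have powx: "\<psi> (of_nat k * (1 / 2 ^ n)) x = (h ^^ k) x" if "x \<in> X" for k x
    unfolding pow by (rule Bd_pow_apply[OF assms(1) hB that])
  have hBij: "h \<in> Bij X" using hB by (simp add: Bd_def bounded_displacement_def carrier_Sym)
  have h: "h \<in> X \<rightarrow> X" "inj_on h X"
    using hBij Bij_imp_funcset by (auto simp: Bij_def bij_betw_def)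
  obtain R where R: "\<forall>x\<in>X. \<exists>n\<le>R. (\<phi> x, \<phi> (h x)) \<in> adj E ^^ n" using near[OF hB] by blast
  have hN: "(h ^^ (2 ^ n)) x = \<psi> 1 x" if "x \<in> X" for x
    using powx[OF that, of "2 ^ n"] by simp
  have "\<exists>k>0. \<forall>x\<in>X. (h ^^ k) x = x"
  proof (rule deep_root_imp_finite_order[OF \<phi> fibre h])
    show "\<exists>n\<le>R. (\<phi> x, \<phi> (h x)) \<in> adj E ^^ n" if "x \<in> X" for x using R that by blast
    show "\<exists>i\<le>S. (\<phi> x, \<phi> ((h ^^ (2 ^ n)) x)) \<in> adj E ^^ i" if "x \<in> X" for x
      unfolding hN[OF that] using S that by blast
    show "(l + 1) ^ (2 * S) * q < 2 ^ n" unfolding n_def[symmetric] by (rule less_exp)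
  qed
  then obtain k where k: "k > 0" "\<forall>x\<in>X. (h ^^ k) x = x" by blast
  define a :: rat where "a = of_nat k * (1 / 2 ^ n)"
  have aD: "a \<in> carrier dyadic_group"
    using dyadicI[of "int k" n] by (simp add: a_def)
  have "\<psi> 0 = (\<lambda>x\<in>X. x)"
    using pow[of 0] by (simp add: one_Bd)
  moreover have "\<psi> a \<in> Bij X"
    using \<psi>B[OF aD] by (simp add: Bd_def bounded_displacement_def carrier_Sym)
  then have "\<psi> a = (\<lambda>x\<in>X. x)"
    using powx[of _ k] k(2) by (intro extensionalityI[of _ X]) (auto simp: a_def Bij_def)
  ultimately have "a = 0" using inj_onD[OF inj _ aD zero_dyadic] by simp
  then show False using k(1) by (simp add: a_def)
qed

end
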